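(* Let $c\ge1$ be an integer. Suppose that there are $2c$ targets in the graph and let $p_i=\frac{1}{2c}$ for every $i\in\{1,2,\ldots,2c\}$. Then any deterministic (possibly adaptive) algorithm requires in the worst case at least $\frac{n}{2}-c$ queries to locate at least one target, even when the graph is an unweighted cycle with $n$ vertices.
   Context: Graphs $G=(V,E)$, $|V|=n$, are connected, simple, undirected, with positive edge weights $w$ (unweighted: all weights $1$); $d$ is the shortest-path distance, and $N(v)$ is the set of neighbors of $v$. For $u\in N(v)$, $N(v,u)=\{x\in V: d(v,x)=w(vu)+d(u,x)\}$. The set of unknown (distinct) targets, placed by an adversary, is $T=\{t_1,\ldots,t_{2c}\}\subseteq V$. A direction query at $v$ independently directs with probability $p_i$ to $t_i$, in which case it returns a neighbor $u\in N(v)$ with $t_i\in N(v,u)$ (possibly chosen adversarially if there are several), without disclosing $i$; if $v=t_i$ this is revealed by the query with probability $p_i$. To locate a target means to determine with certainty some vertex that is a target. *)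

theory Defs
  imports "HOL-Probability.Probability_Mass_Function" "Graph_Theory.Graph_Theory"
begin

text \<open>
  A simple undirected graph is a \<open>pair_graph\<close>: finite, loop-free, with every edge represented by
  its two arcs, which carry the same weight. The shortest-path distance is \<open>\<mu> w\<close>.
\<close>

locale weighted_graph = pair_graph G for G :: "'a pair_pre_digraph" +
  fixes w :: "('a \<times> 'a) weight_fun"
  assumes connected_G: "Digraph_Component.connected (with_proj G)"
    and weight_pos: "e \<in> parcs G \<Longrightarrow> 0 < w e"
    and weight_sym: "(u, v) \<in> parcs G \<Longrightarrow> w (u, v) = w (v, u)"

datatype 'a answer = Here | Towards 'a

text \<open>The queries made so far with their answers, oldest first.\<close>

type_synonym 'a history = "('a \<times> 'a answer) list"

text \<open>
  A deterministic adaptive algorithm is a function \<open>alg\<close> from histories to the next queried vertex.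
  An adversary consists of a placement \<open>t\<close> of the targets \<open>t 1, \<dots>, t m\<close> and a function \<open>s\<close>:
  \<open>s h v i\<close> is the neighbour returned when, after history \<open>h\<close>, a query at \<open>v\<close> directs to \<open>t i\<close>.
\<close>

context weighted_graph
begin

definition neighbours :: "'a \<Rightarrow> 'a set" where
  "neighbours v = {u. (v, u) \<in> parcs G}"

definition via :: "'a \<Rightarrow> 'a \<Rightarrow> 'a set" where
  "via v u = {x \<in> pverts G. \<mu> w v x = ereal (w (v, u)) + \<mu> w u x}"

definition admissible :: "nat \<Rightarrow> (nat \<Rightarrow> 'a) \<Rightarrow> ('a history \<Rightarrow> 'a \<Rightarrow> nat \<Rightarrow> 'a) \<Rightarrow> bool" where
  "admissible m t s \<longleftrightarrow>
     inj_on t {1..m} \<and> t ` {1..m} \<subseteq> pverts G \<and>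
     (\<forall>h. \<forall>v\<in>pverts G. \<forall>i\<in>{1..m}. t i \<noteq> v \<longrightarrow>
        s h v i \<in> neighbours v \<and> t i \<in> via v (s h v i))"

definition answer_pmf ::
    "nat pmf \<Rightarrow> (nat \<Rightarrow> 'a) \<Rightarrow> ('a history \<Rightarrow> 'a \<Rightarrow> nat \<Rightarrow> 'a) \<Rightarrow> 'a history \<Rightarrow> 'a \<Rightarrow> 'a answer pmf" where
  "answer_pmf p t s h v = map_pmf (\<lambda>i. if t i = v then Here else Towards (s h v i)) p"

primrec history_pmf ::
    "nat pmf \<Rightarrow> ('a history \<Rightarrow> 'a) \<Rightarrow> (nat \<Rightarrow> 'a) \<Rightarrow> ('a history \<Rightarrow> 'a \<Rightarrow> nat \<Rightarrow> 'a)
      \<Rightarrow> nat \<Rightarrow> 'a history pmf" where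
  "history_pmf p alg t s 0 = return_pmf []"
| "history_pmf p alg t s (Suc k) =
     bind_pmf (history_pmf p alg t s k)
       (\<lambda>h. map_pmf (\<lambda>a. h @ [(alg h, a)]) (answer_pmf p t s h (alg h)))"

text \<open>
  Some vertex is certain to be a target: it is one for every adversary against which \<open>h\<close> can occur.
\<close>

definition located :: "nat \<Rightarrow> nat pmf \<Rightarrow> ('a history \<Rightarrow> 'a) \<Rightarrow> 'a history \<Rightarrow> bool" where
  "located m p alg h \<longleftrightarrow>
     (\<exists>x. \<forall>t s. admissible m t s \<and> h \<in> set_pmf (history_pmf p alg t s (length h))
        \<longrightarrow> x \<in> t ` {1..m})"

text \<open>
  The least number of queries after which a target is located almost surely against every
  adversary, and \<open>\<infinity>\<close> if there is no such number.
\<close>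

definition worst_case_queries :: "nat \<Rightarrow> nat pmf \<Rightarrow> ('a history \<Rightarrow> 'a) \<Rightarrow> enat" where
  "worst_case_queries m p alg =
     Inf {enat k |k. \<forall>t s. admissible m t s \<longrightarrow>
            (AE h in measure_pmf (history_pmf p alg t s k). located m p alg h)}"

end

definition cycle_graph :: "nat \<Rightarrow> nat pair_pre_digraph" where
  "cycle_graph n =
     \<lparr> pverts = {..<n},
       parcs = {(i, j). i < n \<and> j < n \<and> (j = (i + 1) mod n \<or> i = (j + 1) mod n)} \<rparr>"

lemma weighted_graph_cycle:
  assumes "3 \<le> n"
  shows "weighted_graph (cycle_graph n) (\<lambda>_. 1)"
proof -
  let ?G = "cycle_graph n"
  have loop: "i \<noteq> (i + 1) mod n" if "i < n" for i
    using that assms by (cases "i + 1 = n") auto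
  have fin: "finite (parcs ?G)"
    by (rule finite_subset[of _ "{..<n} \<times> {..<n}"]) (auto simp: cycle_graph_def)
  interpret pair_graph ?G
  proof
    show "symmetric (with_proj ?G)"
      by (auto simp: symmetric_def cycle_graph_def intro!: symI)
  next
    fix e assume "e \<in> parcs ?G"
    then show "fst e \<noteq> snd e" using loop by (force simp: cycle_graph_def)
  qed (use fin in \<open>auto simp: cycle_graph_def\<close>)
  have from0: "0 \<rightarrow>\<^sup>*\<^bsub>with_proj ?G\<^esub> i" if "i < n" for i
    using that
  proof (induction i)
    case 0
    then show ?case by (intro reachable_refl) (simp add: cycle_graph_def)
  next
    case (Suc i)
    have "(i, Suc i) \<in> parcs ?G" using Suc.prems by (simp add: cycle_graph_def)
    then show ?case using Suc.IH Suc.prems reachable_adj_trans by auto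
  qed
  have "u \<rightarrow>\<^sup>*\<^bsub>with_proj ?G\<^esub> v" if "u < n" "v < n" for u v
    using from0[OF that(1)] from0[OF that(2)] symmetric_reachable[OF sym_arcs]
    by (meson reachable_trans)
  then have "Digraph_Component.connected (with_proj ?G)"
    using assms
    by (intro connectedI reachable_mk_symmetricI)
       (auto simp: cycle_graph_def lessThan_empty_iff)
  then show ?thesis by unfold_locales simp_all
qed

end

theory Submission
  imports Defs
begin

text \<open>
  Every query is answered clockwise. Such answers are consistent with any set of targets that
  contains \<open>a\<close> and \<open>a + \<lfloor>n/2\<rfloor>\<close>, as long as \<open>a + \<lfloor>n/2\<rfloor>\<close> has not been queried. With fewer than
  \<open>n/2 - c\<close> queries there is, for every vertex \<open>x\<close>, such a pair that avoids \<open>x\<close>, and it extends to a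
  set of \<open>2c\<close> targets that avoids \<open>x\<close>. Hence \<open>x\<close> is not certain to be a target.
\<close>

section \<open>Distances and directions on the cycle\<close>

definition cw_dist :: "nat \<Rightarrow> nat \<Rightarrow> nat \<Rightarrow> nat" where
  "cw_dist n u v = (if u \<le> v then v - u else v + n - u)"

definition cycle_dist :: "nat \<Rightarrow> nat \<Rightarrow> nat \<Rightarrow> nat" where
  "cycle_dist n u v = min (cw_dist n u v) (n - cw_dist n u v)"

text \<open>A tie, at clockwise distance exactly \<open>n div 2\<close> for even \<open>n\<close>,
  is resolved clockwise. Adding \<open>n\<close> before subtracting 1 avoids truncation at
  \<open>v = 0\<close>.\<close>

definition cycle_toward :: "nat \<Rightarrow> nat \<Rightarrow> nat \<Rightarrow> nat" where
  "cycle_toward n v x =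
     (if cw_dist n v x \<le> n div 2 then (v + 1) mod n else (v + n - 1) mod n)"

lemma add_mod_if:
  "a < n \<Longrightarrow> b < n \<Longrightarrow> (a + b) mod n = (if a + b < n then a + b else a + b - n)" for a b n :: nat
  by (simp add: le_mod_geq)

lemma Suc_mod_if: "i < n \<Longrightarrow> (i + 1) mod n = (if i + 1 = n then 0 else i + 1)" for n :: nat
  by auto

lemma pred_mod_if: "i < n \<Longrightarrow> (i + n - 1) mod n = (if i = 0 then n - 1 else i - 1)" for n :: nat
  by (cases i) auto

lemma cycle_toward_if:
  "v < n \<Longrightarrow> cycle_toward n v x =
    (if cw_dist n v x \<le> n div 2 then if v + 1 = n then 0 else v + 1
     else if v = 0 then n - 1 else v - 1)"
  by (simp only: cycle_toward_def Suc_mod_if pred_mod_if)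

lemma arc_cycle_graph_iff:
  "(i, j) \<in> parcs (cycle_graph n) \<longleftrightarrow> i < n \<and> j < n \<and>
     (j = (if i + 1 = n then 0 else i + 1) \<or> i = (if j + 1 = n then 0 else j + 1))"
  by (auto simp: cycle_graph_def)

lemma cw_dist_less: "u < n \<Longrightarrow> v < n \<Longrightarrow> cw_dist n u v < n"
  by (auto simp: cw_dist_def)

lemma cw_dist_succ:
  assumes "v < n" "x < n" "v \<noteq> x"
  shows "cw_dist n (if v + 1 = n then 0 else v + 1) x + 1 = cw_dist n v x"
  using assms by (cases "v + 1 = n"; cases "v \<le> x") (simp_all add: cw_dist_def)

lemma cw_dist_pred:
  assumes "v < n" "x < n"
  shows "cw_dist n (if v = 0 then n - 1 else v - 1) x
    = (if cw_dist n v x + 1 = n then 0 else cw_dist n v x + 1)"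
  using assms by (cases v; cases "v \<le> x") (auto simp: cw_dist_def)

text \<open>A clockwise step lowers \<open>cw_dist\<close> by one and a counterclockwise step lowers
  \<open>n - cw_dist\<close> by one; \<open>cycle_toward\<close> picks the term that attains the
  minimum.\<close>

lemma cycle_toward_cycle_dist:
  assumes "v < n" "x < n" "v \<noteq> x"
  shows "cycle_dist n v x = 1 + cycle_dist n (cycle_toward n v x) x"
proof (cases "cw_dist n v x \<le> n div 2")
  case True
  then have "cw_dist n (cycle_toward n v x) x + 1 = cw_dist n v x"
    using cw_dist_succ[OF assms] by (simp add: cycle_toward_if assms(1))
  with True show ?thesis unfolding cycle_dist_def by linarith
next
  case False
  then have "cw_dist n (cycle_toward n v x) x
      = (if cw_dist n v x + 1 = n then 0 else cw_dist n v x + 1)"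
    using cw_dist_pred[OF assms(1,2)] by (simp add: cycle_toward_if assms(1))
  with False cw_dist_less[OF assms(1,2)] show ?thesis
    unfolding cycle_dist_def by (auto simp: min_def)
qed

lemma cycle_toward_arc:
  assumes "v < n"
  shows "(v, cycle_toward n v x) \<in> parcs (cycle_graph n)"
  using assms by (auto simp: cycle_toward_if arc_cycle_graph_iff)

lemma cycle_dist_arc_le:
  assumes "(u, v) \<in> parcs (cycle_graph n)" "x < n"
  shows "cycle_dist n u x \<le> 1 + cycle_dist n v x"
proof -
  have less: "u < n" "v < n" using assms(1) by (auto simp: arc_cycle_graph_iff)
  note d = cw_dist_less[OF less(1) assms(2)] cw_dist_less[OF less(2) assms(2)]
  \<comment> \<open>Along an arc, \<open>cw_dist\<close> to \<open>x\<close> changes by exactly one,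
    except at \<open>x\<close> itself, where it can jump between 0 and \<open>n - 1\<close>.\<close>
  consider "u = x" | "v = x" "u \<noteq> x" | "u \<noteq> x" "v \<noteq> x" by blast
  then show ?thesis
  proof cases
    case 1
    then show ?thesis by (simp add: cycle_dist_def cw_dist_def)
  next
    case 2
    then have "cw_dist n u x = 1 \<or> cw_dist n u x + 1 = n"
      using assms(1) by (auto simp: arc_cycle_graph_iff cw_dist_def split: if_splits)
    then show ?thesis unfolding cycle_dist_def by auto
  next
    case 3
    have "v = (if u + 1 = n then 0 else u + 1) \<or> u = (if v + 1 = n then 0 else v + 1)"
      using assms(1) by (simp only: arc_cycle_graph_iff)
    then have "cw_dist n v x + 1 = cw_dist n u x \<or> cw_dist n u x + 1 = cw_dist n v x"
      by (rule disj_forward)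
        (simp_all only: cw_dist_succ[OF less(1) assms(2) 3(1)] cw_dist_succ[OF less(2) assms(2) 3(2)])
    with d show ?thesis unfolding cycle_dist_def by linarith
  qed
qed

text \<open>No walk is shorter, since each arc lowers \<open>cycle_dist\<close> by at most one;
  following \<open>cycle_toward\<close> gives a walk of exactly this length.\<close>

lemma cycle_graph_shortest_path:
  assumes "3 \<le> n" "u < n" "v < n"
  shows "wf_digraph.\<mu> (with_proj (cycle_graph n)) (\<lambda>_. 1) u v = ereal (real (cycle_dist n u v))"
proof -
  interpret weighted_graph "cycle_graph n" "\<lambda>_. 1"
    by (rule weighted_graph_cycle[OF assms(1)])
  have cost: "awalk_cost (\<lambda>_. 1) p = real (length p)" for p :: "(nat \<times> nat) list"
    by (simp add: awalk_cost_def sum_list_triv)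
  have lower: "cycle_dist n a b \<le> length p" if "awalk a p b" "b < n" for a b p
    using that
  proof (induction p arbitrary: a)
    case Nil
    then show ?case by (simp add: awalk_Nil_iff cycle_dist_def cw_dist_def)
  next
    case (Cons e p)
    then have e: "e \<in> parcs (cycle_graph n)" "a = fst e" and "awalk (snd e) p b"
      by (auto simp: awalk_Cons_iff)
    then have "cycle_dist n (snd e) b \<le> length p" using Cons by blast
    moreover have "cycle_dist n a b \<le> 1 + cycle_dist n (snd e) b"
      using e Cons.prems cycle_dist_arc_le[of a "snd e" n b] by simp
    ultimately show ?case by simp
  qed
  have walk: "\<exists>p. awalk a p b \<and> length p = cycle_dist n a b" if "a < n" "b < n" for a b
    using that
  proof (induction "cycle_dist n a b" arbitrary: a rule: less_induct)
    case less
    show ?case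
    proof (cases "a = b")
      case True
      have "a \<in> pverts (cycle_graph n)" using less.prems by (simp add: cycle_graph_def)
      then have "awalk a [] b" using True by (simp add: awalk_Nil_iff)
      then show ?thesis using True by (intro exI[of _ "[]"]) (simp add: cycle_dist_def cw_dist_def)
    next
      case False
      let ?a = "cycle_toward n a b"
      have d: "cycle_dist n a b = 1 + cycle_dist n ?a b"
        using less.prems False by (rule cycle_toward_cycle_dist)
      have arc: "(a, ?a) \<in> parcs (cycle_graph n)" using less.prems(1) by (rule cycle_toward_arc)
      then have "?a < n" by (simp add: arc_cycle_graph_iff)
      then obtain p where "awalk ?a p b" "length p = cycle_dist n ?a b"
        using less d by force
      with arc d show ?thesis
        by (intro exI[of _ "(a, ?a) # p"]) (simp add: awalk_Cons_iff)
    qed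
  qed
  show ?thesis
  proof (rule antisym)
    obtain p where "awalk u p v" "length p = cycle_dist n u v" using walk assms by blast
    then show "\<mu> (\<lambda>_. 1) u v \<le> ereal (real (cycle_dist n u v))"
      using min_cost_le_walk_cost[of u p v "\<lambda>_. 1"] by (simp add: cost)
  next
    show "ereal (real (cycle_dist n u v)) \<le> \<mu> (\<lambda>_. 1) u v"
      unfolding \<mu>_def using lower assms by (intro INF_greatest) (auto simp: cost)
  qed
qed

text \<open>Membership in \<open>via\<close> says that the distance drops by the edge weight 1,
  which is \<open>cycle_toward_cycle_dist\<close>.\<close>

lemma cycle_toward_admissible:
  assumes "3 \<le> n" "inj_on t {1..m}" "t ` {1..m} \<subseteq> {..<n}"
  shows "weighted_graph.admissible (cycle_graph n) (\<lambda>_. 1) m t (\<lambda>h v i. cycle_toward n v (t i))"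
proof -
  interpret weighted_graph "cycle_graph n" "\<lambda>_. 1"
    by (rule weighted_graph_cycle[OF assms(1)])
  have V: "pverts (cycle_graph n) = {..<n}" by (simp add: cycle_graph_def)
  have "cycle_toward n v (t i) \<in> neighbours v \<and> t i \<in> via v (cycle_toward n v (t i))"
    if "v < n" "i \<in> {1..m}" "t i \<noteq> v" for v i
  proof -
    let ?u = "cycle_toward n v (t i)"
    have ti: "t i < n" using that(2) assms(3) by blast
    have arc: "(v, ?u) \<in> parcs (cycle_graph n)"
      using that(1) by (rule cycle_toward_arc)
    then have u: "?u < n" by (simp add: arc_cycle_graph_iff)
    have "real (cycle_dist n v (t i)) = 1 + real (cycle_dist n ?u (t i))"
      using cycle_toward_cycle_dist[of v n "t i"] that ti by simp
    then have "\<mu> (\<lambda>_. 1) v (t i) = ereal 1 + \<mu> (\<lambda>_. 1) ?u (t i)"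
      unfolding cycle_graph_shortest_path[OF assms(1) that(1) ti]
        cycle_graph_shortest_path[OF assms(1) u ti] by simp
    then show ?thesis
      using ti arc by (simp add: neighbours_def via_def V)
  qed
  then show ?thesis using assms by (simp add: admissible_def V)
qed

section \<open>The history with only clockwise answers\<close>

text \<open>No target placement enters, so the same history can be tested against many
  adversaries.\<close>

primrec cw_history :: "nat \<Rightarrow> (nat history \<Rightarrow> nat) \<Rightarrow> nat \<Rightarrow> nat history" where
  "cw_history n alg 0 = []"
| "cw_history n alg (Suc k) =
     (let h = cw_history n alg k in h @ [(alg h, Towards ((alg h + 1) mod n))])"

lemma length_cw_history [simp]: "length (cw_history n alg k) = k"
  by (induction k) (simp_all add: Let_def)

text \<open>At each query one index in the support of \<open>p\<close> whose target yields the
  clockwise answer suffices. The target must differ from the queried vertex, as the answer would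
  otherwise be \<open>Here\<close>.\<close>

lemma cw_history_possible:
  assumes "3 \<le> n"
    and "\<And>j. j < k \<Longrightarrow>
      \<exists>i\<in>set_pmf p. t i \<noteq> alg (cw_history n alg j) \<and> cw_dist n (alg (cw_history n alg j)) (t i) \<le> n div 2"
  shows "cw_history n alg k
    \<in> set_pmf (weighted_graph.history_pmf p alg t (\<lambda>h v i. cycle_toward n v (t i)) k)"
proof -
  interpret weighted_graph "cycle_graph n" "\<lambda>_. 1"
    by (rule weighted_graph_cycle[OF assms(1)])
  show ?thesis
    using assms(2)
  proof (induction k)
    case 0
    then show ?case by simp
  next
    case (Suc k)
    let ?h = "cw_history n alg k"
    obtain i where i: "i \<in> set_pmf p" "t i \<noteq> alg ?h" "cw_dist n (alg ?h) (t i) \<le> n div 2"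
      using Suc.prems by blast
    then have "Towards ((alg ?h + 1) mod n)
        \<in> set_pmf (answer_pmf p t (\<lambda>h v i. cycle_toward n v (t i)) ?h (alg ?h))"
      by (force simp: answer_pmf_def cycle_toward_def)
    then show ?case
      using Suc by (auto simp: Let_def intro!: bexI[of _ ?h])
  qed
qed

section \<open>Choosing targets that avoid a given vertex\<close>

text \<open>The pair cuts the cycle into two clockwise paths, and \<open>v\<close> sees the end of
  its own path ahead of it. From \<open>a\<close> that end is \<open>n div 2\<close> steps away.
  From \<open>(a + n div 2) mod n\<close> it can be \<open>n div 2 + 1\<close> steps away (odd
  \<open>n\<close>), hence the exclusion.\<close>

lemma cw_dist_antipodal_pair:
  assumes "3 \<le> n" "a < n" "v < n" "v \<noteq> (a + n div 2) mod n"
  shows "\<exists>x\<in>{a, (a + n div 2) mod n}. x \<noteq> v \<and> cw_dist n v x \<le> n div 2"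
proof -
  have h: "n div 2 < n" "0 < n div 2" "n \<le> 2 * (n div 2) + 1" using assms(1) by presburger+
  define b where "b = (a + n div 2) mod n"
  have b: "b < n" "b = (if a + n div 2 < n then a + n div 2 else a + n div 2 - n)"
    using assms(2) by (simp add: b_def) (use assms(2) h in \<open>simp only: b_def add_mod_if\<close>)
  show ?thesis
  proof (cases "a \<noteq> v \<and> cw_dist n v a \<le> n div 2")
    \<comment> \<open>Now \<open>v\<close> lies on the clockwise path from \<open>a\<close> to
      \<open>b\<close>, which has \<open>n div 2\<close> edges.\<close>
    case False
    then have "cw_dist n v b \<le> n div 2"
      using assms(1-3) h b by (auto simp: cw_dist_def split: if_splits; linarith)
    then show ?thesis using assms(4) by (auto simp: b_def)
  qed auto
qed

text \<open>Rotation is injective, so at most \<open>card Q + 1\<close> positions rotate into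
  \<open>insert x Q\<close>; \<open>x\<close> itself is one more bad position.\<close>

lemma ex_rotate_avoiding:
  fixes n d x :: nat
  assumes "card Q + 2 < n" "finite Q" "d < n"
  shows "\<exists>a<n. a \<noteq> x \<and> (a + d) mod n \<noteq> x \<and> (a + d) mod n \<notin> Q"
proof (rule ccontr)
  assume H: "\<not> ?thesis"
  let ?f = "\<lambda>a. (a + d) mod n"
  let ?B = "{a \<in> {..<n}. ?f a \<in> insert x Q}"
  have inj: "inj_on ?f ?B"
    using assms(3) by (intro inj_onI) (auto simp: add_mod_if split: if_splits)
  have "?f ` ?B \<subseteq> insert x Q" by blast
  then have "card ?B \<le> card (insert x Q)"
    using assms(2) by (intro card_inj_on_le[OF inj]) simp_all
  also have "\<dots> \<le> Suc (card Q)" by (rule card_insert_le_m1) simp_all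
  finally have B: "card ?B \<le> Suc (card Q)" .
  have "{..<n} \<subseteq> insert x ?B" using H by blast
  then have "card {..<n} \<le> card (insert x ?B)" by (intro card_mono) simp_all
  also have "\<dots> \<le> Suc (card ?B)" by (rule card_insert_le_m1) simp_all
  finally show False using B assms(1) by simp
qed

text \<open>The second conclusion ensures that the unlocated history occurs with positive
  probability, as needed to refute an almost-sure claim.\<close>

lemma cw_history_not_located:
  assumes n: "3 \<le> n" and c: "1 \<le> c" and k: "real k < real n / 2 - real c"
    and p: "{1..2 * c} \<subseteq> set_pmf p"
    and alg: "\<And>h. alg h < n"
  shows "\<not> weighted_graph.located (cycle_graph n) (\<lambda>_. 1) (2 * c) p alg (cw_history n alg k)"
    and "\<exists>t s. weighted_graph.admissible (cycle_graph n) (\<lambda>_. 1) (2 * c) t s \<and>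
      cw_history n alg k \<in> set_pmf (weighted_graph.history_pmf p alg t s k)"
proof -
  interpret weighted_graph "cycle_graph n" "\<lambda>_. 1"
    by (rule weighted_graph_cycle[OF n])
  have avoid: "\<exists>t s. admissible (2 * c) t s \<and> cw_history n alg k \<in> set_pmf (history_pmf p alg t s k) \<and>
      x \<notin> t ` {1..2 * c}" for x
  proof -
    define Q where "Q = (\<lambda>j. alg (cw_history n alg j)) ` {..<k}"
    have "card Q \<le> k" unfolding Q_def using card_image_le[of "{..<k}"] by simp
    \<comment> \<open>This serves twice: with \<open>c \<ge> 1\<close> it leaves room for the
      rotation argument, and it leaves at least \<open>2 * c\<close> vertices other than
      \<open>x\<close>.\<close>
    moreover have kn: "2 * k + 2 * c < n"
      using k by linarith
    ultimately have "card Q + 2 < n" "finite Q" using c n by (auto simp: Q_def)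
    then obtain a where a: "a < n" "a \<noteq> x" "(a + n div 2) mod n \<noteq> x" "(a + n div 2) mod n \<notin> Q"
      using ex_rotate_avoiding[of Q n "n div 2" x] n by auto
    let ?A = "{a, (a + n div 2) mod n}"
    have "card ({..<n} - {x}) \<ge> 2 * c"
      using kn by (simp add: card_Diff_singleton_if) linarith
    moreover have "?A \<subseteq> {..<n} - {x}" using a by auto
    moreover have "card ?A \<le> 2 * c" using c by (simp add: card_insert_if)
    moreover have "finite ({..<n} - {x})" by simp
    \<comment> \<open>The remaining targets are arbitrary: they only add possible answers and cannot
      rule out the clockwise one.\<close>
    ultimately obtain T where T: "?A \<subseteq> T" "T \<subseteq> {..<n} - {x}" "card T = 2 * c"
      using exists_subset_between[of ?A "2 * c" "{..<n} - {x}"] by blast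
    then have "finite T" by (meson finite_Diff finite_lessThan finite_subset)
    then obtain t where t: "bij_betw t {1..2 * c} T"
      using finite_same_card_bij[of "{1..2 * c}" T] T(3) by auto
    let ?s = "\<lambda>h v i. cycle_toward n v (t i)"
    have img: "t ` {1..2 * c} = T" using t by (simp add: bij_betw_def)
    have "admissible (2 * c) t ?s"
      using n t T by (intro cycle_toward_admissible) (auto simp: bij_betw_def)
    moreover have "cw_history n alg k \<in> set_pmf (history_pmf p alg t ?s k)"
    proof (rule cw_history_possible[OF n])
      fix j assume "j < k"
      let ?v = "alg (cw_history n alg j)"
      have "?v \<in> Q" unfolding Q_def by (rule image_eqI[OF refl]) (simp add: \<open>j < k\<close>)
      with a(4) have "?v \<noteq> (a + n div 2) mod n" by metis
      then obtain y where y: "y \<in> ?A" "y \<noteq> ?v" "cw_dist n ?v y \<le> n div 2"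
        using cw_dist_antipodal_pair[OF n a(1) alg[of "cw_history n alg j"]] by blast
      have "y \<in> t ` {1..2 * c}" unfolding img using T(1) y(1) by (rule subsetD)
      then obtain i where i: "i \<in> {1..2 * c}" "y = t i" by (rule imageE)
      show "\<exists>i\<in>set_pmf p. t i \<noteq> ?v \<and> cw_dist n ?v (t i) \<le> n div 2"
        using y(2,3) subsetD[OF p i(1)] unfolding i(2) by (intro bexI[of _ i] conjI)
    qed
    moreover have "x \<notin> t ` {1..2 * c}" using img T(2) by blast
    ultimately show ?thesis by blast
  qed
  \<comment> \<open>Any candidate \<open>x\<close> for a certain target is refuted by the adversary
    that avoids \<open>x\<close>.\<close>
  show "\<not> located (2 * c) p alg (cw_history n alg k)"
    unfolding located_def length_cw_history using avoid by blast
  show "\<exists>t s. admissible (2 * c) t s \<and> cw_history n alg k \<in> set_pmf (history_pmf p alg t s k)"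
    using avoid by blast
qed

theorem theorem7:
  fixes c n :: nat and p :: "nat pmf" and alg :: "nat history \<Rightarrow> nat"
  assumes "1 \<le> c" and "3 \<le> n" and "2 * c \<le> n"
    and "\<And>i. i \<in> {1..2 * c} \<Longrightarrow> pmf p i = 1 / (2 * real c)"
    and "\<And>h. alg h \<in> pverts (cycle_graph n)"
  shows "ereal (real n / 2 - real c)
    \<le> ereal_of_enat (weighted_graph.worst_case_queries (cycle_graph n) (\<lambda>_. 1) (2 * c) p alg)"
proof -
  interpret weighted_graph "cycle_graph n" "\<lambda>_. 1"
    by (rule weighted_graph_cycle[OF assms(2)])
  have p: "{1..2 * c} \<subseteq> set_pmf p"
    using assms(1,4) by (auto simp: set_pmf_iff)
  have alg: "alg h < n" for h using assms(5)[of h] by (simp add: cycle_graph_def)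
  define K where "K = {k. \<forall>t s. admissible (2 * c) t s \<longrightarrow>
    (AE h in measure_pmf (history_pmf p alg t s k). located (2 * c) p alg h)}"
  have bound: "real n / 2 - real c \<le> real k" if "k \<in> K" for k
  proof (rule ccontr)
    assume "\<not> ?thesis"
    then have k: "real k < real n / 2 - real c" by simp
    note * = cw_history_not_located[where alg = alg, OF assms(2,1) k p alg]
    then obtain t s where "admissible (2 * c) t s"
      "cw_history n alg k \<in> set_pmf (history_pmf p alg t s k)" by blast
    \<comment> \<open>An almost-sure property of a \<open>pmf\<close> holds on its whole support,
      which contains this unlocated history.\<close>
    with *(1) that show False by (auto simp: K_def AE_measure_pmf_iff)
  qed
  have worst: "worst_case_queries (2 * c) p alg = Inf (enat ` K)"
    unfolding worst_case_queries_def K_def by (rule arg_cong[where f = Inf]) blast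
  show ?thesis
  proof (cases "K = {}")
    case True
    then show ?thesis by (simp add: worst Inf_enat_def)
  next
    case False
    then obtain j where "enat j \<in> enat ` K" by blast
    then have "Inf (enat ` K) \<in> enat ` K" by (rule wellorder_InfI)
    then obtain k where "Inf (enat ` K) = enat k" "k \<in> K" by (rule imageE)
    then show ?thesis using bound by (simp add: worst)
  qed
qed

end
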